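(* Let $G$ be a graph on $n$ vertices with minimum degree $\delta(G) \geq 7n/8$, whose edges are coloured with three colours. Then the vertex set of $G$ can be covered by monochromatic components of distinct colours, i.e. there are monochromatic components, no two of the same colour (so at most three of them), whose union is $V(G)$.
   Context: The three colours are red, blue and yellow. For a colour $c$, a component of colour $c$ is the vertex set of a connected component of the spanning subgraph of $G$ with vertex set $V(G)$ and edge set the edges of colour $c$ (so a vertex incident with no edge of colour $c$ forms a component of colour $c$ by itself). A monochromatic component is a component of some colour. *)

theory Defs
  imports Complex_Main
begin

datatype colour = Red | Blue | Yellow

definition simple_graph :: "'a set \<Rightarrow> 'a set set \<Rightarrow> bool" where
  "simple_graph V E \<longleftrightarrow> finite V \<and> (\<forall>e\<in>E. e \<subseteq> V \<and> card e = 2)"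

definition degree :: "'a set set \<Rightarrow> 'a \<Rightarrow> nat" where
  "degree E v = card {e \<in> E. v \<in> e}"

definition min_degree :: "'a set \<Rightarrow> 'a set set \<Rightarrow> nat" where
  "min_degree V E = Min (degree E ` V)"

definition connected_in :: "'a set \<Rightarrow> 'a set set \<Rightarrow> ('a \<times> 'a) set" where
  "connected_in V E = {(u, v). u \<in> V \<and> v \<in> V \<and> (u, v) \<in> {(x, y). {x, y} \<in> E}\<^sup>*}"

definition components :: "'a set \<Rightarrow> 'a set set \<Rightarrow> 'a set set" where
  "components V E = V // connected_in V E"

definition colour_components ::
  "'a set \<Rightarrow> 'a set set \<Rightarrow> ('a set \<Rightarrow> colour) \<Rightarrow> colour \<Rightarrow> 'a set set" where
  "colour_components V E col c = components V {e \<in> E. col e = c}"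

end

theory Submission
  imports "HOL-Analysis.Linear_Algebra" Defs
begin

text \<open>
  Encode the three monochromatic components of a vertex \<open>v\<close> by real numbers \<open>(x v, y v, z v)\<close> and
  let \<open>\<phi> v\<close> be the vector in \<open>\<real>\<^sup>8\<close> of all multilinear monomials in these coordinates. The product
  \<open>(x v - x u) (y v - y u) (z v - z u)\<close> is, for fixed \<open>u\<close>, a linear functional of \<open>\<phi> v\<close>; it vanishes
  exactly if \<open>v\<close> lies in one of the three components of \<open>u\<close>. Choose at most eight vertices whose
  images form a basis of the span of all \<open>\<phi> v\<close>. A vertex misses fewer than \<open>n/8\<close> vertices (itself
  excluded), so some \<open>u\<close> shares a component with each of the chosen vertices. Its functional vanishes
  on the basis, hence everywhere: the three components of \<open>u\<close> cover the graph.
\<close>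

definition multilinear_monomials ::
  "real \<Rightarrow> real \<Rightarrow> real \<Rightarrow> real \<times> real \<times> real \<times> real \<times> real \<times> real \<times> real \<times> real" where
  "multilinear_monomials x y z = (x * y * z, x * y, x * z, y * z, x, y, z, 1)"

text \<open>The coefficient vector comes from expanding the product, in the order in which the
  monomials are listed.\<close>

lemma multilinear_monomials_inner:
  "multilinear_monomials x y z \<bullet> (1, - c, - b, - a, b * c, a * c, a * b, - (a * b * c))
   = (x - a) * (y - b) * (z - c)"
  by (simp add: multilinear_monomials_def algebra_simps)

text \<open>\<open>W\<close> is a small test set fixed before \<open>a\<close>, \<open>b\<close>,
  \<open>c\<close>, so a vertex \<open>u\<close> may later be chosen in dependence on
  \<open>W\<close> and its coordinates substituted.\<close>

lemma common_agreement_extends: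
  fixes x y z :: "'a \<Rightarrow> real"
  obtains W where "W \<subseteq> V" "card W \<le> 8"
    and "\<forall>a b c. (\<forall>v\<in>W. x v = a \<or> y v = b \<or> z v = c) \<longrightarrow>
                 (\<forall>v\<in>V. x v = a \<or> y v = b \<or> z v = c)"
proof -
  define \<phi> where "\<phi> v = multilinear_monomials (x v) (y v) (z v)" for v
  obtain B where B: "B \<subseteq> \<phi> ` V" "independent B" "\<phi> ` V \<subseteq> span B"
    by (metis basis_exists)
  \<comment> \<open>One vertex is kept for each basis vector, so \<open>W\<close> inherits the size
    bound of \<open>B\<close>.\<close>
  obtain W where W: "W \<subseteq> V" "inj_on \<phi> W" "B = \<phi> ` W"
    using B(1) by (metis subset_image_inj)
  \<comment> \<open>Eight is the dimension of the target space: one coordinate for each multilinear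
    monomial in three variables.\<close>
  have "card B \<le> 8"
    using independent_bound[OF B(2)] by simp
  then have "card W \<le> 8"
    using W by (simp add: card_image)
  moreover have "\<forall>v\<in>V. x v = a \<or> y v = b \<or> z v = c"
    if W0: "\<forall>v\<in>W. x v = a \<or> y v = b \<or> z v = c" for a b c
  proof
    fix v assume "v \<in> V"
    define \<psi> where "\<psi> = (1::real, - c, - b, - a, b * c, a * c, a * b, - (a * b * c))"
    have \<psi>: "\<phi> u \<bullet> \<psi> = (x u - a) * (y u - b) * (z u - c)" for u
      unfolding \<phi>_def \<psi>_def by (rule multilinear_monomials_inner)
    have "B \<subseteq> {w. w \<bullet> \<psi> = 0}"
      using W0 W(3) \<psi> by auto
    moreover have "subspace {w. w \<bullet> \<psi> = 0}"
      by (simp add: subspace_def inner_left_distrib)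
    ultimately have "span B \<subseteq> {w. w \<bullet> \<psi> = 0}"
      by (rule span_minimal)
    then have "\<phi> v \<bullet> \<psi> = 0"
      using B(3) \<open>v \<in> V\<close> by auto
    then show "x v = a \<or> y v = b \<or> z v = c"
      by (simp add: \<psi>)
  qed
  ultimately show thesis
    using that[OF W(1)] by blast
qed

text \<open>Each vertex of the test set excludes fewer than an eighth of \<open>V\<close>, so at
  most eight of them leave some \<open>u\<close> that agrees with the whole test set, and hence with
  all of \<open>V\<close>.\<close>

lemma exists_agreeing_with_all:
  fixes x y z :: "'a \<Rightarrow> real"
  assumes fin: "finite V" and ne: "V \<noteq> {}"
    and few: "\<And>v. v \<in> V \<Longrightarrow>
      8 * card {u \<in> V. x v \<noteq> x u \<and> y v \<noteq> y u \<and> z v \<noteq> z u} < card V"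
  shows "\<exists>u\<in>V. \<forall>v\<in>V. x v = x u \<or> y v = y u \<or> z v = z u"
proof -
  define D where "D v = {u \<in> V. x v \<noteq> x u \<and> y v \<noteq> y u \<and> z v \<noteq> z u}" for v
  obtain W where W: "W \<subseteq> V" "card W \<le> 8"
    and ext: "\<forall>a b c. (\<forall>v\<in>W. x v = a \<or> y v = b \<or> z v = c) \<longrightarrow>
                      (\<forall>v\<in>V. x v = a \<or> y v = b \<or> z v = c)"
    by (rule common_agreement_extends[of V x y z])
  have finW: "finite W"
    using W(1) fin by (rule finite_subset)
  have "card (\<Union>v\<in>W. D v) < card V"
  \<comment> \<open>The strict bound is summed over \<open>W\<close>, which needs a nonempty index
    set; for empty \<open>W\<close> it comes from \<open>V\<close> being nonempty.\<close>
  proof (cases "W = {}")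
    case True
    then show ?thesis using fin ne by (simp add: card_gt_0_iff)
  next
    case False
    have "8 * card (\<Union>v\<in>W. D v) \<le> (\<Sum>v\<in>W. 8 * card (D v))"
      using card_UN_le[OF finW, of D] by (simp flip: sum_distrib_left)
    also have "\<dots> < (\<Sum>v\<in>W. card V)"
      using few W(1) False finW unfolding D_def by (intro sum_strict_mono) auto
    also have "\<dots> \<le> 8 * card V"
      using W(2) by simp
    finally show ?thesis by simp
  qed
  moreover have "finite (\<Union>v\<in>W. D v)"
    using finW fin by (simp add: D_def)
  ultimately have "\<not> V \<subseteq> (\<Union>v\<in>W. D v)"
    by (meson card_mono not_le)
  then obtain u where "u \<in> V" "u \<notin> (\<Union>v\<in>W. D v)"
    by blast
  then have "\<forall>v\<in>W. x v = x u \<or> y v = y u \<or> z v = z u"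
    by (auto simp: D_def)
  then show ?thesis
    using ext \<open>u \<in> V\<close> by blast
qed

lemma equiv_connected_in: "equiv V (connected_in V E)"
proof (rule equivI)
  show "connected_in V E \<subseteq> V \<times> V"
    by (auto simp: connected_in_def)
  show "refl_on V (connected_in V E)"
    by (auto simp: connected_in_def refl_on_def)
  have "sym ({(x, y). {x, y} \<in> E}\<^sup>*)"
    by (rule sym_rtrancl) (auto simp: sym_def insert_commute)
  then show "sym (connected_in V E)"
    by (auto simp: connected_in_def sym_def)
  show "trans (connected_in V E)"
    by (auto simp: connected_in_def trans_def)
qed

lemma degree_eq_card_neighbours:
  assumes "simple_graph V E"
  shows "degree E v = card {u \<in> V. {u, v} \<in> E}"
proof -
  have "{e \<in> E. v \<in> e} = (\<lambda>u. {u, v}) ` {u \<in> V. {u, v} \<in> E}"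
  proof (intro equalityI subsetI)
    fix e assume e: "e \<in> {e \<in> E. v \<in> e}"
    then have "e \<subseteq> V" "card e = 2"
      using assms by (auto simp: simple_graph_def)
    then obtain u where "e = {u, v}"
      using e by (auto simp: card_2_iff)
    then show "e \<in> (\<lambda>u. {u, v}) ` {u \<in> V. {u, v} \<in> E}"
      using e \<open>e \<subseteq> V\<close> by auto
  qed auto
  moreover have "inj (\<lambda>u. {u, v})"
    by (auto simp: inj_def doubleton_eq_iff)
  ultimately show ?thesis
    unfolding degree_def by (simp add: card_image inj_on_subset)
qed

text \<open>\<open>D\<close>, the neighbourhood of \<open>v\<close> and \<open>v\<close> itself are
  pairwise disjoint; counting \<open>v\<close> makes the inequality strict.\<close>

lemma card_nonneighbours_bound:
  assumes G: "simple_graph V E" and "v \<in> V"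
    and D: "D \<subseteq> V" "v \<notin> D" "\<And>u. u \<in> D \<Longrightarrow> {u, v} \<notin> E"
  shows "card D + min_degree V E < card V"
proof -
  let ?N = "{u \<in> V. {u, v} \<in> E}"
  have fin: "finite V" and "v \<notin> ?N"
    using G by (auto simp: simple_graph_def)
  have "min_degree V E \<le> card ?N"
    using fin \<open>v \<in> V\<close> unfolding min_degree_def degree_eq_card_neighbours[OF G, symmetric]
    by simp
  moreover have "card (D \<union> ?N) = card D + card ?N"
    using fin D by (intro card_Un_disjoint) (auto intro: finite_subset)
  moreover have "card (D \<union> ?N) < card V"
    using fin D \<open>v \<in> V\<close> \<open>v \<notin> ?N\<close> by (intro psubset_card_mono) auto
  ultimately show ?thesis by simp
qed

theorem theorem1p6:
  fixes V :: "'a set" and E :: "'a set set" and col :: "'a set \<Rightarrow> colour"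
  assumes "simple_graph V E"
    and "real (min_degree V E) \<ge> 7 * real (card V) / 8"
  shows "\<exists>F :: (colour \<times> 'a set) set.
           (\<forall>(c, A)\<in>F. A \<in> colour_components V E col c) \<and>
           inj_on fst F \<and>
           (\<Union>(c, A)\<in>F. A) = V"
proof (cases "V = {}")
  case True
  then show ?thesis by (intro exI[of _ "{}"]) auto
next
  case False
  have fin: "finite V"
    using assms(1) by (simp add: simple_graph_def)
  define R where "R c = connected_in V {e \<in> E. col e = c}" for c
  have R: "equiv V (R c)" for c
    unfolding R_def by (rule equiv_connected_in)
  have R_sub: "R c `` {v} \<subseteq> V" for c v
    by (auto simp: R_def connected_in_def)
  \<comment> \<open>An arbitrary injective numbering turns components into real coordinates; only
    equality of codes matters.\<close>
  obtain code :: "'a set \<Rightarrow> nat" where code: "inj_on code (Pow V)"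
    using finite_imp_inj_to_nat_seg[of "Pow V"] fin by auto
  define k where "k c v = real (code (R c `` {v}))" for c v
  have k_eq: "k c v = k c u \<longleftrightarrow> v \<in> R c `` {u}" if "u \<in> V" "v \<in> V" for c u v
  proof -
    have "k c v = k c u \<longleftrightarrow> R c `` {u} = R c `` {v}"
      using inj_on_eq_iff[OF code, of "R c `` {v}" "R c `` {u}"] R_sub
      by (auto simp: k_def)
    also have "\<dots> \<longleftrightarrow> v \<in> R c `` {u}"
      using eq_equiv_class_iff[OF R that] by simp
    finally show ?thesis .
  qed
  have adjacent: "k (col {u, v}) v = k (col {u, v}) u" if "u \<in> V" "v \<in> V" "{u, v} \<in> E" for u v
    using that by (auto simp: k_eq R_def connected_in_def)
  have "\<exists>u\<in>V. \<forall>v\<in>V. k Red v = k Red u \<or> k Blue v = k Blue u \<or> k Yellow v = k Yellow u"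
  proof (rule exists_agreeing_with_all[OF fin False])
    fix v assume "v \<in> V"
    let ?D = "{u \<in> V. k Red v \<noteq> k Red u \<and> k Blue v \<noteq> k Blue u \<and> k Yellow v \<noteq> k Yellow u}"
    \<comment> \<open>An edge would put \<open>u\<close> and \<open>v\<close> into one component of
      its own colour, against the inequality for that colour.\<close>
    have "{u, v} \<notin> E" if "u \<in> ?D" for u
      using that adjacent[of u v] \<open>v \<in> V\<close> by (cases "col {u, v}") auto
    then have "card ?D + min_degree V E < card V"
      using assms(1) \<open>v \<in> V\<close> by (intro card_nonneighbours_bound) auto
    then show "8 * card ?D < card V"
      using assms(2) by linarith
  qed
  then obtain u where "u \<in> V"
    and u: "\<And>v. v \<in> V \<Longrightarrow> v \<in> R Red `` {u} \<or> v \<in> R Blue `` {u} \<or> v \<in> R Yellow `` {u}"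
    using k_eq by blast
  show ?thesis
  proof (intro exI conjI)
    \<comment> \<open>Tagging each component of \<open>u\<close> with its colour gives exactly one
      pair per colour, even if two of the vertex sets coincide.\<close>
    let ?F = "range (\<lambda>c. (c, R c `` {u}))"
    show "\<forall>(c, A)\<in>?F. A \<in> colour_components V E col c"
      using \<open>u \<in> V\<close> by (auto simp: colour_components_def components_def R_def intro: quotientI)
    show "inj_on fst ?F"
      by (auto simp: inj_on_def)
    show "(\<Union>(c, A)\<in>?F. A) = V"
      using u R_sub by fastforce
  qed
qed

end
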